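(* Let $\alpha,\gamma,\kappa>-1$ be real numbers with $\alpha+\kappa>-\frac32$, and let $f(x,y)$ and $g(x,y)$ be symmetric polynomials. Then \[ \int_{\triangle}D_{-}[f(x,y)]\,g(x,y)\,w_{\alpha+1,\gamma,\kappa+1}(x,y)\,dx\,dy=\int_{\triangle}f(x,y)\,D_{+}^{\alpha,\kappa}[g(x,y)]\,w_{\alpha,\gamma,\kappa}(x,y)\,dx\,dy . \]
   Context: All polynomials have real coefficients; symmetric means invariant under interchange of $x$ and $y$. Let $\mathbf{T}^2=\{(x,y)\in\mathbb{R}^2:\ x\ge0,\ y\ge0,\ x+y\le1\}$, $\triangle=\{(x,y)\in\mathbf{T}^2:\ y<x\}$, and \[ w_{\alpha,\gamma,\kappa}(x,y)=(xy)^{\alpha}(1-x-y)^{\gamma}|x-y|^{2\kappa+1}. \] The operators are \[ D_{-}:=\frac{\partial_y-\partial_x}{x-y},\qquad D_{+}^{\alpha,\kappa}:=\frac{-1}{(xy)^\alpha(x-y)^{2\kappa}}D_{-}\left[(xy)^{\alpha+1}(x-y)^{2\kappa+2}\,\cdot\right], \] the latter being equal to \[ D_{+}^{\alpha,\kappa}=xy(x-y)(\partial_x-\partial_y)+4(\kappa+1)xy-(\alpha+1)(x-y)^2 . \] For $f$ a symmetric polynomial, $(\partial_y-\partial_x)f$ is divisible by $x-y$, so $D_-f$ is a polynomial. *)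

theory Defs
  imports "HOL-Analysis.Analysis"
begin

(* Real bivariate polynomials are identified with the functions on the plane they induce, i.e.
   with the functions satisfying real_polynomial_function; this is faithful since the field
   of reals is infinite. *)

definition symmetric_poly :: "(real \<times> real \<Rightarrow> real) \<Rightarrow> bool" where
  "symmetric_poly f \<longleftrightarrow> real_polynomial_function f \<and> (\<forall>x y. f (x, y) = f (y, x))"

definition T2 :: "(real \<times> real) set" where
  "T2 = {(x, y). 0 \<le> x \<and> 0 \<le> y \<and> x + y \<le> 1}"

definition triangle_below :: "(real \<times> real) set" where
  "triangle_below = {(x, y) \<in> T2. y < x}"

definition weight :: "real \<Rightarrow> real \<Rightarrow> real \<Rightarrow> real \<times> real \<Rightarrow> real" where
  "weight \<alpha> \<gamma> \<kappa> = (\<lambda>(x, y).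
     (x * y) powr \<alpha> * (1 - x - y) powr \<gamma> * \<bar>x - y\<bar> powr (2 * \<kappa> + 1))"

definition partial_x :: "(real \<times> real \<Rightarrow> real) \<Rightarrow> real \<times> real \<Rightarrow> real" where
  "partial_x f = (\<lambda>(x, y). deriv (\<lambda>t. f (t, y)) x)"

definition partial_y :: "(real \<times> real \<Rightarrow> real) \<Rightarrow> real \<times> real \<Rightarrow> real" where
  "partial_y f = (\<lambda>(x, y). deriv (\<lambda>t. f (x, t)) y)"

(* The quotient is taken pointwise, so the value on the diagonal x = y is the junk value 0;
   the diagonal is disjoint from triangle_below. *)
definition D_minus :: "(real \<times> real \<Rightarrow> real) \<Rightarrow> real \<times> real \<Rightarrow> real" where
  "D_minus f = (\<lambda>(x, y). (partial_y f (x, y) - partial_x f (x, y)) / (x - y))"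

(* Meaningful where x * y > 0 and x > y, i.e. on triangle_below up to the null set y = 0. *)
definition D_plus :: "real \<Rightarrow> real \<Rightarrow> (real \<times> real \<Rightarrow> real) \<Rightarrow> real \<times> real \<Rightarrow> real" where
  "D_plus \<alpha> \<kappa> g = (\<lambda>(x, y).
     - 1 / ((x * y) powr \<alpha> * (x - y) powr (2 * \<kappa>)) *
     D_minus (\<lambda>(x, y). (x * y) powr (\<alpha> + 1) * (x - y) powr (2 * \<kappa> + 2) * g (x, y)) (x, y))"

lemma real_polynomial_function_partial_derivs:
  fixes g :: "real \<times> real \<Rightarrow> real"
  assumes "real_polynomial_function g"
  shows "((\<lambda>t. g (t, y)) has_real_derivative partial_x g (x, y)) (at x)"
    and "((\<lambda>t. g (x, t)) has_real_derivative partial_y g (x, y)) (at y)"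
proof -
  have g: "g differentiable at p" for p
    using differentiable_at_real_polynomial_function assms by blast
  have "((\<lambda>t. g (t, y)) differentiable at x)"
    using differentiable_chain_at[of "\<lambda>t. (t, y)" x g] g
    by (auto simp: o_def)
  then show "((\<lambda>t. g (t, y)) has_real_derivative partial_x g (x, y)) (at x)"
    by (simp add: partial_x_def DERIV_deriv_iff_real_differentiable)
  have "((\<lambda>t. g (x, t)) differentiable at y)"
    using differentiable_chain_at[of "\<lambda>t. (x, t)" y g] g
    by (auto simp: o_def)
  then show "((\<lambda>t. g (x, t)) has_real_derivative partial_y g (x, y)) (at y)"
    by (simp add: partial_y_def DERIV_deriv_iff_real_differentiable)
qed

lemma D_plus_eq:
  assumes g: "real_polynomial_function g" and "0 < y" "y < x"
  shows "D_plus \<alpha> \<kappa> g (x, y) =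
    x * y * (x - y) * (partial_x g (x, y) - partial_y g (x, y))
    + 4 * (\<kappa> + 1) * (x * y) * g (x, y) - (\<alpha> + 1) * (x - y)\<^sup>2 * g (x, y)"
proof -
  define A where "A = (x * y) powr \<alpha>"
  define B where "B = (x - y) powr (2 * \<kappa>)"
  have pos: "x * y > 0" "x - y > 0" using assms by auto
  then have AB: "A > 0" "B > 0" by (auto simp: A_def B_def)
  have A1: "(x * y) powr (\<alpha> + 1) = A * (x * y)"
    using pos by (simp add: A_def powr_add)
  have B1: "(x - y) powr (2 * \<kappa> + 1) = B * (x - y)"
    using pos by (simp add: B_def powr_add)
  have B2: "(x - y) powr (2 * \<kappa> + 2) = B * (x - y)\<^sup>2"
    using pos by (simp add: B_def powr_add)
  let ?h = "\<lambda>(x, y). (x * y) powr (\<alpha> + 1) * (x - y) powr (2 * \<kappa> + 2) * g (x, y)"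
  note [derivative_intros] = real_polynomial_function_partial_derivs[OF g]
  have e: "2 * \<kappa> + 2 - 1 = 2 * \<kappa> + 1" by simp
  have "((\<lambda>t. ?h (t, y)) has_real_derivative
      ((\<alpha> + 1) * A * y * (B * (x - y)\<^sup>2) + A * (x * y) * ((2 * \<kappa> + 2) * (B * (x - y)))) * g (x, y)
      + A * (x * y) * (B * (x - y)\<^sup>2) * partial_x g (x, y)) (at x)"
    using pos unfolding split
    by (auto intro!: derivative_eq_intros simp: A1 B1 B2 e simp flip: A_def)
  then have px: "partial_x ?h (x, y) =
      ((\<alpha> + 1) * A * y * (B * (x - y)\<^sup>2) + A * (x * y) * ((2 * \<kappa> + 2) * (B * (x - y)))) * g (x, y)
      + A * (x * y) * (B * (x - y)\<^sup>2) * partial_x g (x, y)"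
    unfolding partial_x_def by (auto dest: DERIV_imp_deriv)
  have "((\<lambda>t. ?h (x, t)) has_real_derivative
      ((\<alpha> + 1) * A * x * (B * (x - y)\<^sup>2) - A * (x * y) * ((2 * \<kappa> + 2) * (B * (x - y)))) * g (x, y)
      + A * (x * y) * (B * (x - y)\<^sup>2) * partial_y g (x, y)) (at y)"
    using pos unfolding split
    by (auto intro!: derivative_eq_intros simp: A1 B1 B2 e simp flip: A_def)
  then have py: "partial_y ?h (x, y) =
      ((\<alpha> + 1) * A * x * (B * (x - y)\<^sup>2) - A * (x * y) * ((2 * \<kappa> + 2) * (B * (x - y)))) * g (x, y)
      + A * (x * y) * (B * (x - y)\<^sup>2) * partial_y g (x, y)"
    unfolding partial_y_def by (auto dest: DERIV_imp_deriv)
  have "D_plus \<alpha> \<kappa> g (x, y) = - 1 / (A * B) * ((partial_y ?h (x, y) - partial_x ?h (x, y)) / (x - y))"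
    by (simp add: D_plus_def D_minus_def A_def B_def)
  also have "\<dots> = x * y * (x - y) * (partial_x g (x, y) - partial_y g (x, y))
    + 4 * (\<kappa> + 1) * (x * y) * g (x, y) - (\<alpha> + 1) * (x - y)\<^sup>2 * g (x, y)"
    unfolding px py using AB pos by (simp add: field_simps power2_eq_square)
  finally show ?thesis .
qed

end

theory Submission
  imports Defs
begin

text \<open>
  In the coordinates \<open>s = x + y\<close> and \<open>y\<close> the operator \<open>\<partial>\<^sub>y - \<partial>\<^sub>x\<close> is the derivative in \<open>y\<close> at
  fixed \<open>s\<close>, and the factor \<open>(1 - x - y) powr \<gamma>\<close> depends on \<open>s\<close> alone. Hence the difference of the
  two integrands is the derivative in \<open>y\<close> of
  \<open>f g (x y) powr (\<alpha> + 1) (x - y) powr (2 \<kappa> + 2) (1 - s) powr \<gamma>\<close>, which vanishes at both ends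
  \<open>y = 0\<close> and \<open>y = s / 2\<close> of the antidiagonal segment. By Fubini it remains to check integrability,
  where every term is dominated by \<open>(1 - s) powr \<gamma>\<close> times a multiple of \<open>y powr a + (x - y) powr b\<close>
  with exponents above \<open>-1\<close>.
\<close>

section \<open>Partial derivatives of polynomials and the derivative along antidiagonals\<close>

lemma partial_x_eq:
  assumes "\<And>x y. ((\<lambda>t. p (t, y)) has_real_derivative q (x, y)) (at x)"
  shows "partial_x p = q"
  using assms by (auto simp: partial_x_def fun_eq_iff intro!: DERIV_imp_deriv)

lemma partial_y_eq:
  assumes "\<And>x y. ((\<lambda>t. p (x, t)) has_real_derivative q (x, y)) (at y)"
  shows "partial_y p = q"
  using assms by (auto simp: partial_y_def fun_eq_iff intro!: DERIV_imp_deriv)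

text \<open>With its analogue for \<open>partial_y\<close>, this keeps the terms produced by
  \<open>D_minus\<close> and \<open>D_plus\<close> polynomial, hence bounded on the
  triangle.\<close>

lemma real_polynomial_function_partial_x:
  assumes "real_polynomial_function p"
  shows "real_polynomial_function (partial_x p)"
  using assms
proof induction
  case (linear p)
  then interpret bounded_linear p .
  have "p (t, y) = t * p (1, 0) + p (0, y)" for t y
    using add[of "(t, 0)" "(0, y)"] scale[of t "(1, 0)"] by simp
  then have "(\<lambda>t. p (t, y)) = (\<lambda>t. t * p (1, 0) + p (0, y))" for y
    by (rule ext)
  moreover have "((\<lambda>t. t * p (1, 0) + p (0, y)) has_real_derivative p (1, 0)) (at x)" for x y
    by (auto intro!: derivative_eq_intros)
  ultimately have "partial_x p = (\<lambda>_. p (1, 0))"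
    by (intro partial_x_eq) metis
  then show ?case
    by (simp add: real_polynomial_function.intros(2))
next
  case (const c)
  have "partial_x (\<lambda>_. c) = (\<lambda>_. 0)"
    by (intro partial_x_eq) (auto intro!: derivative_eq_intros)
  then show ?case
    by (simp add: real_polynomial_function.intros(2))
next
  case (add p q)
  note [derivative_intros] =
    real_polynomial_function_partial_derivs(1)[OF add.hyps(1)]
    real_polynomial_function_partial_derivs(1)[OF add.hyps(2)]
  have "partial_x (\<lambda>z. p z + q z) = (\<lambda>z. partial_x p z + partial_x q z)"
    by (intro partial_x_eq) (auto intro!: derivative_eq_intros)
  then show ?case
    using add by (simp add: real_polynomial_function.intros(3))
next
  case (mult p q)
  note [derivative_intros] =
    real_polynomial_function_partial_derivs(1)[OF mult.hyps(1)]
    real_polynomial_function_partial_derivs(1)[OF mult.hyps(2)]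
  have "partial_x (\<lambda>z. p z * q z) = (\<lambda>z. partial_x p z * q z + p z * partial_x q z)"
    by (intro partial_x_eq) (auto intro!: derivative_eq_intros)
  then show ?case
    using mult by (simp add: real_polynomial_function.intros(3) real_polynomial_function.intros(4))
qed

lemma real_polynomial_function_partial_y:
  assumes "real_polynomial_function p"
  shows "real_polynomial_function (partial_y p)"
  using assms
proof induction
  case (linear p)
  then interpret bounded_linear p .
  have "p (x, t) = t * p (0, 1) + p (x, 0)" for x t
    using add[of "(0, t)" "(x, 0)"] scale[of t "(0, 1)"] by simp
  then have "(\<lambda>t. p (x, t)) = (\<lambda>t. t * p (0, 1) + p (x, 0))" for x
    by (rule ext)
  moreover have "((\<lambda>t. t * p (0, 1) + p (x, 0)) has_real_derivative p (0, 1)) (at y)" for x y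
    by (auto intro!: derivative_eq_intros)
  ultimately have "partial_y p = (\<lambda>_. p (0, 1))"
    by (intro partial_y_eq) metis
  then show ?case
    by (simp add: real_polynomial_function.intros(2))
next
  case (const c)
  have "partial_y (\<lambda>_. c) = (\<lambda>_. 0)"
    by (intro partial_y_eq) (auto intro!: derivative_eq_intros)
  then show ?case
    by (simp add: real_polynomial_function.intros(2))
next
  case (add p q)
  note [derivative_intros] =
    real_polynomial_function_partial_derivs(2)[OF add.hyps(1)]
    real_polynomial_function_partial_derivs(2)[OF add.hyps(2)]
  have "partial_y (\<lambda>z. p z + q z) = (\<lambda>z. partial_y p z + partial_y q z)"
    by (intro partial_y_eq) (auto intro!: derivative_eq_intros)
  then show ?case
    using add by (simp add: real_polynomial_function.intros(3))
next
  case (mult p q)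
  note [derivative_intros] =
    real_polynomial_function_partial_derivs(2)[OF mult.hyps(1)]
    real_polynomial_function_partial_derivs(2)[OF mult.hyps(2)]
  have "partial_y (\<lambda>z. p z * q z) = (\<lambda>z. partial_y p z * q z + p z * partial_y q z)"
    by (intro partial_y_eq) (auto intro!: derivative_eq_intros)
  then show ?case
    using mult by (simp add: real_polynomial_function.intros(3) real_polynomial_function.intros(4))
qed

text \<open>The total derivative \<open>p'\<close> exists, and by linearity its value on the
  direction (-1, 1) is its value on (0, 1) minus its value on (1, 0), that is, the difference of the
  two partial derivatives.\<close>

lemma real_polynomial_function_antidiagonal_deriv:
  fixes p :: "real \<times> real \<Rightarrow> real"
  assumes "real_polynomial_function p"
  shows "((\<lambda>t. p (s - t, t)) has_real_derivative
    partial_y p (s - t, t) - partial_x p (s - t, t)) (at t)"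
proof -
  obtain p' where p': "(p has_derivative p') (at (s - t, t))"
    using differentiable_at_real_polynomial_function[OF assms] differentiable_def by blast
  then interpret p': bounded_linear p'
    by (rule has_derivative_bounded_linear)
  have "((\<lambda>u. p (u, t)) has_derivative (\<lambda>h. p' (h, 0))) (at (s - t))"
    by (rule has_derivative_compose[of "\<lambda>u. (u, t)" "\<lambda>h. (h, 0)" _ UNIV p p'], (rule derivative_eq_intros refl)+)
       (auto intro!: p')
  also have "(\<lambda>h. p' (h, 0)) = (*) (p' (1, 0))"
  proof
    show "p' (h, 0) = p' (1, 0) * h" for h
      using p'.scale[of h "(1, 0)"] by (simp add: mult.commute)
  qed
  finally have x: "p' (1, 0) = partial_x p (s - t, t)"
    using real_polynomial_function_partial_derivs(1)[OF assms]
    by (intro DERIV_unique) (auto simp: has_field_derivative_def)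
  have "((\<lambda>u. p (s - t, u)) has_derivative (\<lambda>h. p' (0, h))) (at t)"
    by (rule has_derivative_compose[of "\<lambda>u. (s - t, u)" "\<lambda>h. (0, h)" _ UNIV p p'], (rule derivative_eq_intros refl)+)
       (auto intro!: p')
  also have "(\<lambda>h. p' (0, h)) = (*) (p' (0, 1))"
  proof
    show "p' (0, h) = p' (0, 1) * h" for h
      using p'.scale[of h "(0, 1)"] by (simp add: mult.commute)
  qed
  finally have y: "p' (0, 1) = partial_y p (s - t, t)"
    using real_polynomial_function_partial_derivs(2)[OF assms]
    by (intro DERIV_unique) (auto simp: has_field_derivative_def)
  have "((\<lambda>u. p (s - u, u)) has_derivative (\<lambda>h. p' (- h, h))) (at t)"
    by (rule has_derivative_compose[of "\<lambda>u. (s - u, u)" "\<lambda>h. (- h, h)" _ UNIV p p'], (rule derivative_eq_intros refl)+)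
       (auto intro!: p')
  also have "(\<lambda>h. p' (- h, h)) = (*) (p' (0, 1) - p' (1, 0))"
  proof
    fix h
    show "p' (- h, h) = (p' (0, 1) - p' (1, 0)) * h"
      using p'.scale[of h "(- 1, 1)"] p'.diff[of "(0, 1)" "(1, 0)"] by (simp add: mult.commute)
  qed
  finally show ?thesis
    by (simp add: has_field_derivative_def x y)
qed

section \<open>The change of variables from (x, y) to (s, y) with s = x + y\<close>

lemma distr_lborel_shear:
  "distr lborel lborel (\<lambda>(s, y). (s - y, y)) = (lborel :: (real \<times> real) measure)"
    (is "distr _ _ ?h = _")
proof (rule measure_eqI)
  have h: "?h \<in> lborel \<rightarrow>\<^sub>M lborel"
    by (auto intro!: borel_measurable_continuous_onI continuous_intros simp: case_prod_unfold)
  fix A :: "(real \<times> real) set"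
  assume "A \<in> sets (distr lborel lborel ?h)"
  then have A: "A \<in> sets lborel" by simp
  have B: "?h -` A \<in> sets lborel"
    using measurable_sets[OF h A] by simp
  \<comment> \<open>At fixed y the shear is a translation by -y, so it preserves the length of
    horizontal slices; integrating these lengths over y gives equality of the planar
    measures.\<close>
  have slice: "emeasure lborel ((\<lambda>s. (s, y)) -` (?h -` A)) = emeasure lborel ((\<lambda>x. (x, y)) -` A)"
    for y
  proof -
    have S: "(\<lambda>x. (x, y)) -` A \<in> sets borel"
      using A measurable_sets[of "\<lambda>x. (x, y)" borel lborel A]
      by (auto intro!: borel_measurable_continuous_onI continuous_intros)
    have "emeasure lborel ((\<lambda>x. (x, y)) -` A)
      = emeasure (distr lborel borel ((+) (- y))) ((\<lambda>x. (x, y)) -` A)"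
      by (simp add: lborel_distr_plus)
    also have "\<dots> = emeasure lborel ((\<lambda>s. (s, y)) -` (?h -` A))"
      using S by (subst emeasure_distr) (auto simp: vimage_def)
    finally show ?thesis by simp
  qed
  have "emeasure (distr lborel lborel ?h) A = emeasure lborel (?h -` A)"
    using h A by (subst emeasure_distr) auto
  also have "\<dots> = emeasure lborel A"
    using lborel_pair.emeasure_pair_measure_alt2[of A]
      lborel_pair.emeasure_pair_measure_alt2[of "?h -` A"]
    unfolding lborel_prod slice using A B by simp
  finally show "emeasure (distr lborel lborel ?h) A = emeasure lborel A" .
qed simp

lemma
  fixes F :: "real \<times> real \<Rightarrow> real"
  assumes [measurable]: "F \<in> borel_measurable borel"
  shows integrable_lborel_shear:
      "integrable lborel (\<lambda>(s, y). F (s - y, y)) \<longleftrightarrow> integrable lborel F"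
    and integral_lborel_shear:
      "(\<integral>(s, y). F (s - y, y) \<partial>lborel) = integral\<^sup>L lborel F"
proof -
  have h: "(\<lambda>(s, y). (s - y, y :: real)) \<in> lborel \<rightarrow>\<^sub>M lborel"
    by (auto intro!: borel_measurable_continuous_onI continuous_intros simp: case_prod_unfold)
  show "integrable lborel (\<lambda>(s, y). F (s - y, y)) \<longleftrightarrow> integrable lborel F"
    using integrable_distr_eq[OF h, of F] unfolding distr_lborel_shear by (simp add: case_prod_unfold)
  show "(\<integral>(s, y). F (s - y, y) \<partial>lborel) = integral\<^sup>L lborel F"
    using integral_distr[OF h, of F] unfolding distr_lborel_shear by (simp add: case_prod_unfold)
qed

section \<open>Integrability of the weights on the triangle\<close>

lemma integrable_lborel_product_affine:
  fixes u v :: "real \<Rightarrow> real"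
  assumes u: "integrable lborel u" and v: "integrable lborel v" and "r \<noteq> 0"
  shows "integrable lborel (\<lambda>(s, y). u s * v (k * s + r * y))"
proof -
  note [measurable] = borel_measurable_integrable[OF u, simplified]
    borel_measurable_integrable[OF v, simplified]
  have "integrable (lborel \<Otimes>\<^sub>M lborel) (\<lambda>(s, y). u s * v (k * s + r * y))"
  proof (rule lborel_pair.Fubini_integrable)
    \<comment> \<open>An affine substitution in y absorbs the shift \<open>k * s\<close>, so the
      inner integral of the norm is a constant multiple of the absolute value of
      \<open>u s\<close>.\<close>
    have "(\<integral>y. norm (case (s, y) of (s, y) \<Rightarrow> u s * v (k * s + r * y)) \<partial>lborel)
      = \<bar>u s\<bar> * ((\<integral>y. \<bar>v y\<bar> \<partial>lborel) / \<bar>r\<bar>)" for s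
      using lborel_integral_real_affine[OF \<open>r \<noteq> 0\<close>, of "\<lambda>y. \<bar>v y\<bar>" "k * s"] \<open>r \<noteq> 0\<close>
      by (simp add: abs_mult)
    then show "integrable lborel
      (\<lambda>s. \<integral>y. norm (case (s, y) of (s, y) \<Rightarrow> u s * v (k * s + r * y)) \<partial>lborel)"
      using u by simp
    show "AE s in lborel. integrable lborel (\<lambda>y. case (s, y) of (s, y) \<Rightarrow> u s * v (k * s + r * y))"
      using lborel_integrable_real_affine[OF v \<open>r \<noteq> 0\<close>] by simp
  qed measurable
  then show ?thesis by (simp add: lborel_prod)
qed

lemma set_integrable_powr_unit_interval:
  assumes "a > -1"
  shows "set_integrable lborel {0<..<1} (\<lambda>u::real. u powr a)"
proof -
  have "(\<lambda>u. u powr a) absolutely_integrable_on {0..1}"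
    using assms by (intro nonnegative_absolutely_integrable_1 integrable_on_powr_from_0) auto
  then have "set_integrable lborel {0..1} (\<lambda>u. u powr a)"
    unfolding set_integrable_def by (subst (asm) integrable_completion) auto
  then show ?thesis
    by (rule set_integrable_subset) auto
qed

text \<open>The interior of \<open>triangle_below\<close>: without the edges y = 0 and x + y = 1,
  every base of a \<open>powr\<close> below is strictly positive.\<close>

definition open_triangle :: "(real \<times> real) set" where
  "open_triangle = {(x, y). 0 < y \<and> y < x \<and> x + y < 1}"

lemma open_triangle_borel [measurable]: "open_triangle \<in> sets borel"
proof -
  have "open_triangle = {z. 0 < snd z} \<inter> {z. snd z < fst z} \<inter> {z. fst z + snd z < 1}"
    by (auto simp: open_triangle_def)
  also have "open \<dots>"
    by (intro open_Int open_Collect_less continuous_intros)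
  finally show ?thesis by simp
qed

text \<open>For b = 2 \<kappa> + 1 this is the weight on the open triangle. The exponent b is left
  free so that the factors x y and powers of x - y coming from the operators can be absorbed into
  the exponents.\<close>

definition jacobi_monomial :: "real \<Rightarrow> real \<Rightarrow> real \<Rightarrow> real \<times> real \<Rightarrow> real" where
  "jacobi_monomial a b c = (\<lambda>(x, y). (x * y) powr a * (x - y) powr b * (1 - x - y) powr c)"

lemma jacobi_monomial_measurable [measurable]: "jacobi_monomial a b c \<in> borel_measurable borel"
  unfolding jacobi_monomial_def case_prod_unfold borel_prod[symmetric] by measurable

lemma real_polynomial_function_measurable:
  fixes p :: "real \<times> real \<Rightarrow> real"
  assumes "real_polynomial_function p"
  shows "p \<in> borel_measurable borel"
  using assms continuous_real_polymonial_function
  by (intro borel_measurable_continuous_onI continuous_at_imp_continuous_on) auto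

lemma real_polynomial_function_bounded_triangle:
  fixes p :: "real \<times> real \<Rightarrow> real"
  assumes "real_polynomial_function p"
  obtains B where "\<And>z. z \<in> open_triangle \<Longrightarrow> \<bar>p z\<bar> \<le> B"
proof -
  have "continuous_on ({0..1} \<times> {0..1}) p"
    using assms continuous_real_polymonial_function by (intro continuous_at_imp_continuous_on) auto
  then have "bounded (p ` ({0..1} \<times> {0..1}))"
    by (intro compact_imp_bounded compact_continuous_image compact_Times) auto
  then obtain B where "\<And>z. z \<in> {0..1} \<times> {0..1} \<Longrightarrow> \<bar>p z\<bar> \<le> B"
    unfolding bounded_iff by force
  moreover have "open_triangle \<subseteq> {0..1} \<times> {0..1}"
    by (auto simp: open_triangle_def)
  ultimately show ?thesis using that by blast
qed

text \<open>This separates the singularities at y = 0 and x = y, which meet at the origin. If a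
  \<ge> 0, the factor \<open>(x * y) powr a\<close> is at most 1, leaving
  \<open>(x - y) powr b\<close>. If a < 0, then x \<ge> x - y bounds
  \<open>x powr a * (x - y) powr b\<close> by \<open>(x - y) powr (a + b)\<close>, which is at most
  1, leaving \<open>y powr a\<close>. The sum covers both cases.\<close>

lemma jacobi_monomial_le:
  assumes "a \<ge> 0 \<or> b \<ge> 0 \<and> a + b \<ge> 0" and "(x, y) \<in> open_triangle"
  shows "jacobi_monomial a b c (x, y) \<le> (y powr a + (x - y) powr b) * (1 - x - y) powr c"
proof -
  have xy: "0 < y" "y < x" "x + y < 1" "x < 1"
    using assms(2) by (auto simp: open_triangle_def)
  have "(x * y) powr a * (x - y) powr b \<le> y powr a + (x - y) powr b"
  proof (cases "a \<ge> 0")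
    case True
    then have "(x * y) powr a \<le> 1"
      using xy mult_le_one[of x y] by (intro powr_le1) auto
    then have "(x * y) powr a * (x - y) powr b \<le> (x - y) powr b"
      by (intro mult_left_le_one_le) auto
    then show ?thesis
      by (smt (verit) powr_ge_zero)
  next
    case False
    then have "x powr a \<le> (x - y) powr a"
      using xy by (intro powr_mono2') auto
    then have "x powr a * (x - y) powr b \<le> (x - y) powr a * (x - y) powr b"
      by (intro mult_right_mono) auto
    also have "\<dots> = (x - y) powr (a + b)"
      by (simp add: powr_add)
    also have "\<dots> \<le> 1"
      using False assms(1) xy by (intro powr_le1) auto
    finally have "y powr a * (x powr a * (x - y) powr b) \<le> y powr a"
      by (intro mult_left_le) auto
    then have "(x * y) powr a * (x - y) powr b \<le> y powr a"
      using xy by (simp add: powr_mult mult_ac)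
    then show ?thesis
      by (smt (verit) powr_ge_zero)
  qed
  then show ?thesis
    unfolding jacobi_monomial_def split by (intro mult_right_mono) auto
qed

lemma set_integrable_jacobi_monomial:
  assumes "a > -1" "b > -1" "c > -1" and ab: "a \<ge> 0 \<or> b \<ge> 0 \<and> a + b \<ge> 0"
    and p: "real_polynomial_function p"
  shows "set_integrable lborel open_triangle (\<lambda>z. p z * jacobi_monomial a b c z)"
proof -
  note [measurable] = real_polynomial_function_measurable[OF p]
  \<comment> \<open>Powers cut off to the unit interval are integrable on the whole line, so the
    dominating function can be a sum of products on the whole plane.\<close>
  define w where "w e u = indicator {0<..<1} u * u powr e" for e u :: real
  have w: "integrable lborel (w e)" if "e > -1" for e
    using set_integrable_powr_unit_interval[OF that] by (simp add: set_integrable_def w_def[abs_def])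
  have wc: "integrable lborel (\<lambda>s. w c (1 - s))"
    using lborel_integrable_real_affine[OF w[OF \<open>c > -1\<close>], of "-1" 1] by simp
  obtain B where B: "\<And>z. z \<in> open_triangle \<Longrightarrow> \<bar>p z\<bar> \<le> B"
    using real_polynomial_function_bounded_triangle[OF p] by blast
  let ?F = "\<lambda>z. indicator open_triangle z * (p z * jacobi_monomial a b c z)"
  \<comment> \<open>In the coordinates (s, y) one has 1 - x - y = 1 - s and x - y = s - 2 y. On the
    triangle 1 - s, y and s - 2 y all lie in (0, 1), so no cut-off is active there. The redundant
    coefficients match the form \<open>k * s + r * y\<close> of the product lemma.\<close>
  let ?K = "\<lambda>(s, y). B * (w c (1 - s) * w a (0 * s + 1 * y) + w c (1 - s) * w b (1 * s + -2 * y))"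
  have "integrable lborel ?K"
    using integrable_lborel_product_affine[OF wc w[OF \<open>a > -1\<close>], of 1 0]
      integrable_lborel_product_affine[OF wc w[OF \<open>b > -1\<close>], of "-2" 1]
    by (simp add: case_prod_unfold)
  then have "integrable lborel (\<lambda>(s, y). ?F (s - y, y))"
  proof (rule Bochner_Integration.integrable_bound)
    show "(\<lambda>(s, y). ?F (s - y, y)) \<in> borel_measurable lborel"
      unfolding case_prod_unfold by (simp add: borel_prod[symmetric]) measurable
    have "\<bar>?F (s - y, y)\<bar> \<le> \<bar>?K (s, y)\<bar>" for s y
    proof (cases "(s - y, y) \<in> open_triangle")
      case True
      then have sy: "0 < y" "2 * y < s" "s < 1"
        by (auto simp: open_triangle_def)
      have nonneg: "0 \<le> jacobi_monomial a b c (s - y, y)"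
        by (simp add: jacobi_monomial_def)
      have "\<bar>?F (s - y, y)\<bar> = \<bar>p (s - y, y)\<bar> * jacobi_monomial a b c (s - y, y)"
        using True nonneg by (simp add: abs_mult)
      also have "\<dots> \<le> B * ((y powr a + (s - y - y) powr b) * (1 - (s - y) - y) powr c)"
        using B[OF True] jacobi_monomial_le[OF ab True, of c] nonneg
        by (intro mult_mono) auto
      also have "\<dots> = ?K (s, y)"
        using sy by (simp add: w_def algebra_simps)
      finally show ?thesis by linarith
    qed simp
    then show "AE z in lborel. norm (case z of (s, y) \<Rightarrow> ?F (s - y, y)) \<le> norm (?K z)"
      by (intro AE_I2) (auto simp: split_paired_all simp del: abs_mult)
  qed
  then have "integrable lborel ?F"
    by (subst (asm) integrable_lborel_shear) measurable
  then show ?thesis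
    by (simp add: set_integrable_def)
qed

section \<open>Integration along antidiagonal segments and the adjointness relation\<close>

lemma set_lebesgue_integral_eq_0_of_FTC:
  fixes \<Phi> \<phi> :: "real \<Rightarrow> real"
  assumes "a \<le> b" "continuous_on {a..b} \<Phi>" "\<Phi> a = \<Phi> b"
    and "\<And>t. t \<in> {a<..<b} \<Longrightarrow> (\<Phi> has_real_derivative \<phi> t) (at t)"
  shows "(LINT t:{a<..<b}|lborel. \<phi> t) = 0"
  \<comment> \<open>If \<open>\<phi>\<close> is not integrable, the integral takes the junk value 0.\<close>
proof (cases "set_integrable lborel {a<..<b} \<phi>")
  case True
  \<comment> \<open>Differentiability is asked for in the interior only: in the application the
    powers in \<Phi> may have unbounded derivatives at the endpoints.\<close>
  have "(\<phi> has_integral \<Phi> b - \<Phi> a) {a..b}"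
    using assms by (intro fundamental_theorem_of_calculus_interior)
      (auto simp: has_real_derivative_iff_has_vector_derivative)
  then have "integral {a<..<b} \<phi> = 0"
    using assms(3) integral_open_interval_real[of a b \<phi>] by (auto simp: integral_unique)
  then show ?thesis
    using set_borel_integral_eq_integral(2)[OF True] by simp
next
  case False
  then show ?thesis
    by (simp add: set_integrable_def set_lebesgue_integral_def not_integrable_integral_eq)
qed

theorem proposition5p1:
  fixes \<alpha> \<gamma> \<kappa> :: real and f g :: "real \<times> real \<Rightarrow> real"
  assumes "\<alpha> > -1" and "\<gamma> > -1" and "\<kappa> > -1" and "\<alpha> + \<kappa> > -3/2"
    and "symmetric_poly f" and "symmetric_poly g"
  shows "set_integrable lborel triangle_below (\<lambda>p. D_minus f p * g p * weight (\<alpha> + 1) \<gamma> (\<kappa> + 1) p) \<and>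
         set_integrable lborel triangle_below (\<lambda>p. f p * D_plus \<alpha> \<kappa> g p * weight \<alpha> \<gamma> \<kappa> p) \<and>
         (LINT p:triangle_below|lborel. D_minus f p * g p * weight (\<alpha> + 1) \<gamma> (\<kappa> + 1) p) =
         (LINT p:triangle_below|lborel. f p * D_plus \<alpha> \<kappa> g p * weight \<alpha> \<gamma> \<kappa> p)"
proof -
  have f: "real_polynomial_function f" and g: "real_polynomial_function g"
    using assms by (auto simp: symmetric_poly_def)
  define Pf Pg where "Pf z = partial_y f z - partial_x f z"
    and "Pg z = partial_y g z - partial_x g z" for z
  have Pf: "real_polynomial_function Pf" and Pg: "real_polynomial_function Pg"
    unfolding Pf_def[abs_def] Pg_def[abs_def] using f g
    by (auto intro!: real_polynomial_function_diff real_polynomial_function_partial_x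
        real_polynomial_function_partial_y)
  \<comment> \<open>In \<open>?L\<close> the quotient in \<open>D_minus\<close> lowers the exponent
    2 \<kappa> + 3 of x - y by one. In \<open>?R\<close> the three terms of \<open>D_plus_eq\<close>
    raise the exponents (\<alpha>, 2 \<kappa> + 1) of x y and x - y by (1, 1), (1, 0) and (0, 2)
    respectively.\<close>
  let ?L = "\<lambda>z. (Pf z * g z) * jacobi_monomial (\<alpha> + 1) (2 * \<kappa> + 2) \<gamma> z"
  let ?R = "\<lambda>z. ((- f z * Pg z) * jacobi_monomial (\<alpha> + 1) (2 * \<kappa> + 2) \<gamma> z
      + (4 * (\<kappa> + 1) * (f z * g z)) * jacobi_monomial (\<alpha> + 1) (2 * \<kappa> + 1) \<gamma> z)
      + (- (\<alpha> + 1) * (f z * g z)) * jacobi_monomial \<alpha> (2 * \<kappa> + 3) \<gamma> z"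
  \<comment> \<open>The weight vanishes on the edges \<open>y = 0\<close> and \<open>x + y = 1\<close> because \<open>0 powr a = 0\<close> for every
      \<open>a\<close>, so the following identities hold everywhere.\<close>
  have L: "indicator triangle_below z * (D_minus f z * g z * weight (\<alpha> + 1) \<gamma> (\<kappa> + 1) z)
      = indicator open_triangle z * ?L z" for z
  proof (cases z)
    case (Pair x y)
    show ?thesis
    proof (cases "z \<in> open_triangle")
      case True
      then have xy: "0 < y" "y < x" "x + y < 1" and T: "z \<in> triangle_below"
        by (auto simp: open_triangle_def triangle_below_def T2_def Pair)
      have "(x - y) powr (2 * (\<kappa> + 1) + 1) = (x - y) powr (2 * \<kappa> + 2) * (x - y)"
        using xy powr_add[of "x - y" "2 * \<kappa> + 2" 1] by (simp add: algebra_simps)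
      with True T xy show ?thesis
        by (simp add: Pair D_minus_def weight_def jacobi_monomial_def Pf_def)
    next
      case False
      then have "z \<in> triangle_below \<Longrightarrow> y = 0 \<or> 1 - x - y = 0"
        by (auto simp: open_triangle_def triangle_below_def T2_def Pair)
      with False show ?thesis
        by (auto simp: Pair weight_def indicator_def)
    qed
  qed
  have R: "indicator triangle_below z * (f z * D_plus \<alpha> \<kappa> g z * weight \<alpha> \<gamma> \<kappa> z)
      = indicator open_triangle z * ?R z" for z
  proof (cases z)
    case (Pair x y)
    show ?thesis
    proof (cases "z \<in> open_triangle")
      case True
      then have xy: "0 < y" "y < x" "x + y < 1" and T: "z \<in> triangle_below"
        by (auto simp: open_triangle_def triangle_below_def T2_def Pair)
      have pows: "(x - y) powr (2 * \<kappa> + 2) = (x - y) powr (2 * \<kappa> + 1) * (x - y)"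
        "(x - y) powr (2 * \<kappa> + 3) = (x - y) powr (2 * \<kappa> + 1) * (x - y)\<^sup>2"
        "(x * y) powr (\<alpha> + 1) = (x * y) powr \<alpha> * (x * y)"
        using xy powr_add[of "x - y" "2 * \<kappa> + 1" 1] powr_add[of "x - y" "2 * \<kappa> + 1" 2]
        by (auto simp: powr_add)
      from True T xy show ?thesis
        by (simp add: Pair D_plus_eq[OF g] weight_def jacobi_monomial_def Pg_def pows)
           (simp add: algebra_simps power2_eq_square)
    next
      case False
      then have "z \<in> triangle_below \<Longrightarrow> y = 0 \<or> 1 - x - y = 0"
        by (auto simp: open_triangle_def triangle_below_def T2_def Pair)
      with False show ?thesis
        by (auto simp: Pair weight_def indicator_def)
    qed
  qed
  have intL: "integrable lborel (\<lambda>z. indicator open_triangle z * ?L z)"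
    using set_integrable_jacobi_monomial[of "\<alpha> + 1" "2 * \<kappa> + 2" \<gamma> "\<lambda>z. Pf z * g z"] assms Pf g
    by (simp add: set_integrable_def real_polynomial_function.intros(4))
  \<comment> \<open>The first two terms fall under the alternative a \<ge> 0 with a = \<alpha> + 1.
    The third has a = \<alpha>, possibly negative, and falls under the other one: b = 2 \<kappa> + 3
    > 1 and a + b > 0.\<close>
  have "set_integrable lborel open_triangle ?R"
    using assms f g Pg
    by (intro set_integral_add set_integrable_jacobi_monomial)
       (auto intro!: real_polynomial_function.intros(2-4) real_polynomial_function_minus)
  then have intR: "integrable lborel (\<lambda>z. indicator open_triangle z * ?R z)"
    by (simp add: set_integrable_def)
  define G where "G z = indicator open_triangle z * (?L z - ?R z)" for z
  have G: "integrable lborel G"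
    using Bochner_Integration.integrable_diff[OF intL intR] by (simp add: G_def[abs_def] algebra_simps)
  note [measurable] = borel_measurable_integrable[OF G, simplified]
  have inner: "(\<integral>y. G (s - y, y) \<partial>lborel) = 0" for s
  proof (cases "0 < s \<and> s < 1")
    case True
    define \<Phi> where "\<Phi> t = f (s - t, t) * g (s - t, t) * ((s - t) * t) powr (\<alpha> + 1)
      * (s - 2 * t) powr (2 * \<kappa> + 2) * (1 - s) powr \<gamma>" for t
    have "(LINT t:{0<..<s/2}|lborel. (?L (s - t, t) - ?R (s - t, t))) = 0"
    proof (rule set_lebesgue_integral_eq_0_of_FTC[of _ _ \<Phi>])
      show "0 \<le> s / 2" using True by simp
      have "continuous_on UNIV (\<lambda>t. p (s - t, t))" if "real_polynomial_function p" for p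
        using real_polynomial_function_antidiagonal_deriv[OF that]
        by (intro continuous_at_imp_continuous_on) (auto intro: DERIV_isCont)
      note cont = this[THEN continuous_on_subset, OF _ subset_UNIV]
      \<comment> \<open>Positivity of \<alpha> + 1 and 2 \<kappa> + 2 matters here:
        \<open>0 powr a = 0\<close> gives zero endpoint values for any exponent, but continuity at a
        zero of the base needs a positive one.\<close>
      show "continuous_on {0..s/2} \<Phi>"
        unfolding \<Phi>_def using assms
        by (intro continuous_on_mult continuous_on_powr' continuous_on_diff continuous_on_const
              continuous_on_id cont f g) auto
      show "\<Phi> 0 = \<Phi> (s/2)"
        using assms by (simp add: \<Phi>_def)
      fix t assume "t \<in> {0<..<s/2}"
      then have t: "0 < t" "2 * t < s" "t < s" by auto
      have pows: "(s - 2 * t) powr (2 * \<kappa> + 2) = (s - 2 * t) powr (2 * \<kappa> + 1) * (s - 2 * t)"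
        "(s - 2 * t) powr (2 * \<kappa> + 3) = (s - 2 * t) powr (2 * \<kappa> + 1) * (s - 2 * t)\<^sup>2"
        "((s - t) * t) powr (\<alpha> + 1) = ((s - t) * t) powr \<alpha> * ((s - t) * t)"
        using t powr_add[of "s - 2 * t" "2 * \<kappa> + 1" 1] powr_add[of "s - 2 * t" "2 * \<kappa> + 1" 2]
        by (auto simp: powr_add)
      have e: "2 * \<kappa> + 2 - 1 = 2 * \<kappa> + 1" by simp
      \<comment> \<open>Since (s - t) t has derivative s - 2 t, which is x - y, \<open>d1\<close>
        yields the third term of \<open>- ?R\<close>; \<open>d2\<close> yields the second, as -2 (2
        \<kappa> + 2) = -4 (\<kappa> + 1). Differentiating f and g yields \<open>?L\<close> and the
        first term of \<open>- ?R\<close>.\<close>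
      have d1: "((\<lambda>t. ((s - t) * t) powr (\<alpha> + 1)) has_real_derivative
          (\<alpha> + 1) * ((s - t) * t) powr \<alpha> * (s - 2 * t)) (at t)"
        using t by (auto intro!: derivative_eq_intros simp: algebra_simps)
      have d2: "((\<lambda>t. (s - 2 * t) powr (2 * \<kappa> + 2)) has_real_derivative
          (2 * \<kappa> + 2) * (s - 2 * t) powr (2 * \<kappa> + 1) * (- 2)) (at t)"
        using t by (auto intro!: derivative_eq_intros simp: e)
      have *: "s - t - t = s - 2 * t" "1 - (s - t) - t = 1 - s" by simp_all
      note fg = real_polynomial_function_antidiagonal_deriv[OF f, of s t]
        real_polynomial_function_antidiagonal_deriv[OF g, of s t]
      show "(\<Phi> has_real_derivative ?L (s - t, t) - ?R (s - t, t)) (at t)"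
        unfolding \<Phi>_def
        by (rule DERIV_cong, rule DERIV_cmult_right[OF DERIV_mult[OF DERIV_mult[OF DERIV_mult[OF fg] d1] d2]])
           (unfold jacobi_monomial_def split * pows Pf_def Pg_def,
            simp add: algebra_simps power2_eq_square)
    qed
    moreover have "indicator open_triangle (s - y, y) = (indicator {0<..<s/2} y :: real)" for y
      using True by (auto simp: open_triangle_def indicator_def)
    ultimately show ?thesis
      by (simp add: G_def set_lebesgue_integral_def)
  next
    case False
    then have "(s - y, y) \<notin> open_triangle" for y
      by (auto simp: open_triangle_def)
    then show ?thesis by (simp add: G_def)
  qed
  \<comment> \<open>Integrability of \<open>G\<close> as a function of two variables is what
    licenses the iterated integral with y innermost, where \<open>inner\<close> applies for every
    s.\<close>
  have "integrable (lborel \<Otimes>\<^sub>M lborel) (\<lambda>(s, y). G (s - y, y))"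
    using G by (simp add: lborel_prod integrable_lborel_shear)
  then have "integral\<^sup>L lborel G = (\<integral>s. \<integral>y. G (s - y, y) \<partial>lborel \<partial>lborel)"
    using lborel_pair.integral_fst'[of "\<lambda>(s, y). G (s - y, y)"]
    by (simp add: lborel_prod integral_lborel_shear)
  then have "integral\<^sup>L lborel G = 0"
    by (simp add: inner)
  then have "(\<integral>z. indicator open_triangle z * ?L z \<partial>lborel)
      = (\<integral>z. indicator open_triangle z * ?R z \<partial>lborel)"
    using Bochner_Integration.integral_diff[OF intL intR]
    unfolding G_def right_diff_distrib by linarith
  then show ?thesis
    unfolding set_integrable_def set_lebesgue_integral_def real_scaleR_def L R
    using intL intR by blast
qed

end
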